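(* Let $\Phi=[\phi_1,\dots,\phi_M]\in\mathbb{R}^{m\times M}$ be a unit norm frame for $\mathbb{R}^m$ with coherence $\mu(\Phi)$. Let $$D^{+}_{I_m}:=\{(i,j): 1\le i<j\le M,\ \phi_i^T\phi_j=\mu(\Phi)\},\qquad D^{-}_{I_m}:=\{(i,j): 1\le i<j\le M,\ \phi_i^T\phi_j=-\mu(\Phi)\},$$ put $\phi'_{ij}:=\frac{\phi_i\phi_j^T+\phi_j\phi_i^T}{2}$, and consider the matrix of size $m^2\times(M+|D^{+}_{I_m}|+|D^{-}_{I_m}|)$ $$\Psi=\Big[\big(\mathrm{vec}(\phi_i\phi_i^T)\big)_{i=1}^{M}\quad \big(\mathrm{vec}(\phi'_{ij})\big)_{(i,j)\in D^{+}_{I_m}}\quad -\big(\mathrm{vec}(\phi'_{ij})\big)_{(i,j)\in D^{-}_{I_m}}\Big].$$ If there does not exist a vector $r\in\mathbb{R}^{M+|D^{+}_{I_m}|+|D^{-}_{I_m}|}$ in the nullspace of $\Psi$ (i.e. $\Psi r=0$) satisfying both $$\sum_{k=1}^{M}r_k=-\mu(\Phi)\qquad\text{and}\qquad \sum_{k=M+1}^{M+|D^{+}_{I_m}|+|D^{-}_{I_m}|}r_k=1,$$ then there exists an invertible linear operator $G\in\mathbb{R}^{m\times m}$ such that $\mu(G\Phi)<\mu(\Phi)$.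
   Context: A family $\{\phi_i\}_{i=1}^M$ in $\mathbb{R}^m$ is a frame for $\mathbb{R}^m$ if there are constants $0<A\le B<\infty$ with $A\|z\|^2\le\sum_{i=1}^M|\langle z,\phi_i\rangle|^2\le B\|z\|^2$ for all $z\in\mathbb{R}^m$ (equivalently, the $m\times M$ matrix with columns $\phi_i$ has full row rank). It is identified with the matrix $\Phi=[\phi_1,\dots,\phi_M]$. It is a unit norm frame if $\|\phi_i\|_2=1$ for all $i$. The coherence of a frame $\Phi$ with nonzero columns (and $M\ge2$, so that the maximum is over a nonempty set) is $$\mu(\Phi)=\max_{1\le i,j\le M,\ i\ne j}\frac{|\phi_i^T\phi_j|}{\|\phi_i\|_2\|\phi_j\|_2}.$$ For an invertible $G\in\mathbb{R}^{m\times m}$, $G\Phi$ is the frame with columns $G\phi_1,\dots,G\phi_M$ (not necessarily of unit norm; the coherence is normalized). The operation $\mathrm{vec}$ applied to a $p\times q$ matrix gives the vector of length $pq$ obtained by stacking its columns vertically, one below the other. The columns of $\Psi$ are ordered in blocks: first the $M$ columns indexed by $i=1,\dots,M$, then those indexed by $D^{+}_{I_m}$, then those indexed by $D^{-}_{I_m}$ (each in a fixed order). *)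

theory Defs
  imports Complex_Main "Jordan_Normal_Form.Matrix"
begin

definition l2_norm :: "real vec \<Rightarrow> real" where
  "l2_norm v = sqrt (v \<bullet> v)"

definition is_frame :: "nat \<Rightarrow> real mat \<Rightarrow> bool" where
  "is_frame m \<Phi> \<longleftrightarrow> dim_row \<Phi> = m \<and>
     (\<exists>A B. 0 < A \<and> A \<le> B \<and>
       (\<forall>z \<in> carrier_vec m.
          A * (l2_norm z)\<^sup>2 \<le> (\<Sum>i<dim_col \<Phi>. \<bar>z \<bullet> col \<Phi> i\<bar>\<^sup>2) \<and>
          (\<Sum>i<dim_col \<Phi>. \<bar>z \<bullet> col \<Phi> i\<bar>\<^sup>2) \<le> B * (l2_norm z)\<^sup>2))"

definition unit_norm_frame :: "nat \<Rightarrow> real mat \<Rightarrow> bool" where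
  "unit_norm_frame m \<Phi> \<longleftrightarrow> is_frame m \<Phi> \<and> (\<forall>i<dim_col \<Phi>. l2_norm (col \<Phi> i) = 1)"

(* Only meaningful for nonzero columns and at least two of them (the set is empty otherwise). *)
definition coherence :: "real mat \<Rightarrow> real" where
  "coherence \<Phi> = Max {\<bar>col \<Phi> i \<bullet> col \<Phi> j\<bar> / (l2_norm (col \<Phi> i) * l2_norm (col \<Phi> j)) | i j.
     i < dim_col \<Phi> \<and> j < dim_col \<Phi> \<and> i \<noteq> j}"

(* Column indices are 0-based, so the pairs satisfy 0 \<le> i < j < M. *)
definition D_plus :: "real mat \<Rightarrow> (nat \<times> nat) set" where
  "D_plus \<Phi> = {(i, j). i < j \<and> j < dim_col \<Phi> \<and> col \<Phi> i \<bullet> col \<Phi> j = coherence \<Phi>}"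

definition D_minus :: "real mat \<Rightarrow> (nat \<times> nat) set" where
  "D_minus \<Phi> = {(i, j). i < j \<and> j < dim_col \<Phi> \<and> col \<Phi> i \<bullet> col \<Phi> j = - coherence \<Phi>}"

(* The matrix v w^T. *)
definition outer_prod :: "real vec \<Rightarrow> real vec \<Rightarrow> real mat" where
  "outer_prod v w = mat (dim_vec v) (dim_vec w) (\<lambda>(a, b). v $ a * w $ b)"

(* Stacking the columns of a p x q matrix: position k = b * p + a (with a < p) holds entry (a, b). *)
definition vectorize :: "real mat \<Rightarrow> real vec" where
  "vectorize A = vec (dim_row A * dim_col A) (\<lambda>k. A $$ (k mod dim_row A, k div dim_row A))"

definition sym_outer :: "real mat \<Rightarrow> nat \<times> nat \<Rightarrow> real mat" where
  "sym_outer \<Phi> = (\<lambda>(i, j). (1 / 2) \<cdot>\<^sub>m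
     (outer_prod (col \<Phi> i) (col \<Phi> j) + outer_prod (col \<Phi> j) (col \<Phi> i)))"

(* ps and ns enumerate D_plus and D_minus; they fix the order of the last two blocks of columns. *)
definition Psi :: "real mat \<Rightarrow> (nat \<times> nat) list \<Rightarrow> (nat \<times> nat) list \<Rightarrow> real mat" where
  "Psi \<Phi> ps ns = mat_of_cols ((dim_row \<Phi>)\<^sup>2)
     (map (\<lambda>i. vectorize (outer_prod (col \<Phi> i) (col \<Phi> i))) [0..<dim_col \<Phi>]
      @ map (\<lambda>p. vectorize (sym_outer \<Phi> p)) ps
      @ map (\<lambda>p. - vectorize (sym_outer \<Phi> p)) ns)"

end

theory Submission
  imports Defs "Jordan_Normal_Form.Determinant"
begin

text \<open>
  Unsolvability of a linear system yields a direction in which the coherence decreases to first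
  order. The vector \<open>r\<close> carries no sign constraint, so its non-existence is an ordinary Fredholm
  alternative (\<open>fredholm_alternative\<close>): extend every column of \<open>\<Psi>\<close> by the two coefficients of its
  unknown in the sum constraints; then some functional vanishes on all extended columns but is
  positive on the right-hand side \<open>(0, -\<mu>, 1)\<close>. Its coordinates form a square matrix \<open>X\<close> and two
  numbers \<open>a\<close> and \<open>b\<close>. With \<open>S\<close> the symmetric part of \<open>X\<close> this reads (\<open>descent_direction\<close>):
  \<open>\<phi>\<^sub>i\<^sup>T S \<phi>\<^sub>i = -a\<close> for all \<open>i\<close>, \<open>\<phi>\<^sub>i\<^sup>T S \<phi>\<^sub>j\<close> is \<open>-b\<close> or \<open>b\<close> on the pairs where \<open>\<phi>\<^sub>i\<^sup>T \<phi>\<^sub>j\<close> is \<open>\<mu>\<close> or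
  \<open>-\<mu>\<close>, and \<open>a \<mu> < b\<close>.

  Now let \<open>G = 1 + (t/2) X\<close>, so that \<open>G\<^sup>T G = 1 + t S + O(t\<^sup>2)\<close>. The normalized inner product of
  \<open>G \<phi>\<^sub>i\<close> and \<open>G \<phi>\<^sub>j\<close> has derivative \<open>\<phi>\<^sub>i\<^sup>T S \<phi>\<^sub>j + a \<phi>\<^sub>i\<^sup>T \<phi>\<^sub>j\<close> at \<open>t = 0\<close>
  (\<open>normalized_inner_product_derivative\<close>). Where
  \<open>\<phi>\<^sub>i\<^sup>T \<phi>\<^sub>j = \<mu>\<close> this is \<open>a \<mu> - b < 0\<close>, and where \<open>\<phi>\<^sub>i\<^sup>T \<phi>\<^sub>j = -\<mu>\<close> it is \<open>b - a \<mu> > 0\<close>. Hence for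
  small \<open>t > 0\<close> these inner products move strictly inside the interval from \<open>-\<mu>\<close> to \<open>\<mu>\<close>, the finitely
  many others stay inside by continuity, and \<open>G\<close> remains invertible.
\<close>

section \<open>The alternative for linear systems\<close>

text \<open>
  Orthogonal projection onto a span by Gram-Schmidt: a new vector is replaced by its residual \<open>v\<close>
  against the earlier ones, and the component along \<open>v\<close> is then removed. Working with functions on an
  arbitrary finite index set leaves room to append coordinates for extra equations.
\<close>

lemma orthogonal_decomposition:
  fixes A :: "'k \<Rightarrow> 'i \<Rightarrow> real"
  assumes "finite K" and I: "finite I"
  shows "\<exists>c y. (\<forall>a\<in>I. b a = (\<Sum>k\<in>K. c k * A k a) + y a) \<and>
               (\<forall>k\<in>K. (\<Sum>a\<in>I. y a * A k a) = 0)"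
  using assms(1)
proof (induction K arbitrary: b)
  case empty
  show ?case by (intro exI[of _ "\<lambda>_. 0"] exI[of _ b]) simp
next
  case (insert k K)
  obtain c y where b: "\<And>a. a \<in> I \<Longrightarrow> b a = (\<Sum>j\<in>K. c j * A j a) + y a"
    and y: "\<And>j. j \<in> K \<Longrightarrow> (\<Sum>a\<in>I. y a * A j a) = 0"
    using insert.IH[of b] by blast
  obtain d v where Ak: "\<And>a. a \<in> I \<Longrightarrow> A k a = (\<Sum>j\<in>K. d j * A j a) + v a"
    and v: "\<And>j. j \<in> K \<Longrightarrow> (\<Sum>a\<in>I. v a * A j a) = 0"
    using insert.IH[of "A k"] by blast
  \<comment> \<open>If \<open>v\<close> vanishes on \<open>I\<close>, division by zero gives \<open>s = 0\<close>, and no correction is needed.\<close>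
  define s where "s = (\<Sum>a\<in>I. y a * v a) / (\<Sum>a\<in>I. v a * v a)"
  define y' where "y' a = y a - s * v a" for a
  define c' where "c' j = (if j = k then s else c j - s * d j)" for j
  have decomp: "b a = (\<Sum>j\<in>insert k K. c' j * A j a) + y' a" if "a \<in> I" for a
  proof -
    have "(\<Sum>j\<in>K. c' j * A j a) = (\<Sum>j\<in>K. (c j - s * d j) * A j a)"
      using insert.hyps by (intro sum.cong) (auto simp: c'_def)
    also have "\<dots> = (\<Sum>j\<in>K. c j * A j a) - s * (\<Sum>j\<in>K. d j * A j a)"
      by (simp add: algebra_simps sum_subtractf sum_distrib_left)
    finally show ?thesis
      using insert.hyps b[OF that] Ak[OF that]
      by (simp add: y'_def c'_def algebra_simps)
  qed
  have orthK: "(\<Sum>a\<in>I. y' a * A j a) = 0" if "j \<in> K" for j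
  proof -
    have "(\<Sum>a\<in>I. y' a * A j a) = (\<Sum>a\<in>I. y a * A j a) - s * (\<Sum>a\<in>I. v a * A j a)"
      by (simp add: y'_def algebra_simps sum_subtractf sum_distrib_left)
    then show ?thesis using y v that by simp
  qed
  have orthv: "(\<Sum>a\<in>I. y' a * v a) = 0"
  proof (cases "(\<Sum>a\<in>I. v a * v a) = 0")
    case True
    then have "\<forall>a\<in>I. v a = 0"
      using I by (subst (asm) sum_nonneg_eq_0_iff) auto
    then show ?thesis by simp
  next
    case False
    have "(\<Sum>a\<in>I. y' a * v a) = (\<Sum>a\<in>I. y a * v a) - s * (\<Sum>a\<in>I. v a * v a)"
      by (simp add: y'_def algebra_simps sum_subtractf sum_distrib_left)
    then show ?thesis using False by (simp add: s_def)
  qed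
  have "(\<Sum>a\<in>I. y' a * A k a) = (\<Sum>a\<in>I. y' a * (\<Sum>j\<in>K. d j * A j a)) + (\<Sum>a\<in>I. y' a * v a)"
    by (simp add: Ak distrib_left sum.distrib)
  also have "(\<Sum>a\<in>I. y' a * (\<Sum>j\<in>K. d j * A j a)) = (\<Sum>j\<in>K. d j * (\<Sum>a\<in>I. y' a * A j a))"
    by (simp add: sum_distrib_left algebra_simps) (rule sum.swap)
  also have "\<dots> = 0" using orthK by simp
  finally have "(\<Sum>a\<in>I. y' a * A k a) = 0" using orthv by simp
  then show ?case
    using decomp orthK by (intro exI[of _ c'] exI[of _ y']) auto
qed

text \<open>
  The certificate is the residual \<open>y\<close> of the right-hand side itself: it is nonzero because the
  system is unsolvable, and its pairing with \<open>b\<close> is its own squared norm. This fixes the sign of the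
  pairing, which determines the direction of the perturbation below.
\<close>

lemma fredholm_alternative:
  fixes A :: "'k \<Rightarrow> 'i \<Rightarrow> real"
  assumes K: "finite K" and I: "finite I"
    and unsolvable: "\<not> (\<exists>c. \<forall>a\<in>I. (\<Sum>k\<in>K. c k * A k a) = b a)"
  obtains y where "\<And>k. k \<in> K \<Longrightarrow> (\<Sum>a\<in>I. y a * A k a) = 0" and "(\<Sum>a\<in>I. y a * b a) > 0"
proof -
  obtain c y where b: "\<And>a. a \<in> I \<Longrightarrow> b a = (\<Sum>k\<in>K. c k * A k a) + y a"
    and y: "\<And>k. k \<in> K \<Longrightarrow> (\<Sum>a\<in>I. y a * A k a) = 0"
    using orthogonal_decomposition[OF K I, of b A] by blast
  obtain a where a: "a \<in> I" "y a \<noteq> 0"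
  proof (rule ccontr)
    assume "\<not> thesis"
    then have "\<forall>a\<in>I. y a = 0" using that by blast
    then show False using unsolvable b by auto
  qed
  have "(\<Sum>a\<in>I. y a * b a) = (\<Sum>a\<in>I. y a * (\<Sum>k\<in>K. c k * A k a)) + (\<Sum>a\<in>I. y a * y a)"
    by (simp add: b distrib_left sum.distrib)
  also have "(\<Sum>a\<in>I. y a * (\<Sum>k\<in>K. c k * A k a)) = (\<Sum>k\<in>K. c k * (\<Sum>a\<in>I. y a * A k a))"
    by (simp add: sum_distrib_left algebra_simps) (rule sum.swap)
  also have "\<dots> = 0" using y by simp
  finally have "(\<Sum>a\<in>I. y a * b a) = (\<Sum>a\<in>I. y a * y a)" by simp
  moreover have "(\<Sum>a\<in>I. y a * y a) > 0"
    using I a by (intro sum_pos2[of _ a]) (auto simp: zero_less_mult_iff)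
  ultimately show ?thesis using that[OF y] by simp
qed

section \<open>From the columns of \<Psi> to a bilinear form\<close>

text \<open>
  A linear functional on vectorized matrices, evaluated on rank-one matrices, is a bilinear form;
  \<open>b * m + a\<close> is the position of the entry \<open>(a, b)\<close> in the stacking order.
\<close>

lemma vectorize_outer_prod_pairing:
  fixes x :: "nat \<Rightarrow> real"
  assumes v: "v \<in> carrier_vec m" and w: "w \<in> carrier_vec m"
  shows "(\<Sum>l<m\<^sup>2. x l * vectorize (outer_prod v w) $ l)
    = v \<bullet> (mat m m (\<lambda>(a, b). x (b * m + a)) *\<^sub>v w)"
proof -
  have "(\<Sum>l<m\<^sup>2. x l * vectorize (outer_prod v w) $ l)
      = (\<Sum>l<m * m. x l * (v $ (l mod m) * w $ (l div m)))"
    unfolding power2_eq_square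
  proof (rule sum.cong[OF refl])
    fix l assume "l \<in> {..<m * m}"
    then have "l < m * m" "l mod m < m" "l div m < m"
      by (auto simp: less_mult_imp_div_less intro!: mod_less_divisor gr0I)
    then show "x l * vectorize (outer_prod v w) $ l = x l * (v $ (l mod m) * w $ (l div m))"
      using v w by (auto simp: vectorize_def outer_prod_def)
  qed
  also have "\<dots> = (\<Sum>(a, b)\<in>{0..<m} \<times> {0..<m}. x (b * m + a) * (v $ a * w $ b))"
  proof (rule sum.reindex_bij_witness[of _ "\<lambda>(a, b). b * m + a" "\<lambda>l. (l mod m, l div m)"])
    fix p :: "nat \<times> nat" assume "p \<in> {0..<m} \<times> {0..<m}"
    then obtain a b where p: "p = (a, b)" "a < m" "b < m" by auto
    have "b * m + a < Suc b * m" using p by simp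
    also have "\<dots> \<le> m * m" using p by (intro mult_right_mono) auto
    finally show "(case p of (a, b) \<Rightarrow> b * m + a) \<in> {..<m * m}" using p by simp
  qed (auto simp: less_mult_imp_div_less intro!: mod_less_divisor gr0I)
  also have "\<dots> = (\<Sum>a<m. \<Sum>b<m. x (b * m + a) * (v $ a * w $ b))"
    by (simp add: sum.cartesian_product atLeast0LessThan)
  also have "\<dots> = v \<bullet> (mat m m (\<lambda>(a, b). x (b * m + a)) *\<^sub>v w)"
    using v w
    by (auto simp: scalar_prod_def sum_distrib_left atLeast0LessThan ac_simps intro!: sum.cong)
  finally show ?thesis .
qed

text \<open>
  This is \<open>v\<^sup>T S w\<close> for the symmetric part \<open>S\<close> of \<open>X\<close>. Only \<open>S\<close> is seen by the columns of \<open>\<Psi>\<close> and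
  by inner products to first order, so \<open>X\<close> itself need not be symmetrized.
\<close>
definition sym_form :: "real mat \<Rightarrow> real vec \<Rightarrow> real vec \<Rightarrow> real" where
  "sym_form X v w = (v \<bullet> (X *\<^sub>v w) + w \<bullet> (X *\<^sub>v v)) / 2"

lemma vectorize_sym_outer_pairing:
  fixes x :: "nat \<Rightarrow> real"
  assumes \<Phi>: "\<Phi> \<in> carrier_mat m M"
  shows "(\<Sum>l<m\<^sup>2. x l * vectorize (sym_outer \<Phi> (i, j)) $ l)
    = sym_form (mat m m (\<lambda>(a, b). x (b * m + a))) (col \<Phi> i) (col \<Phi> j)"
proof -
  have c: "col \<Phi> k \<in> carrier_vec m" for k using \<Phi> by (metis carrier_matD(1) col_dim)
  let ?V = "\<lambda>i j. vectorize (outer_prod (col \<Phi> i) (col \<Phi> j))"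
  have "vectorize (sym_outer \<Phi> (i, j)) $ l = (?V i j $ l + ?V j i $ l) / 2"
    if "l < m\<^sup>2" for l
  proof -
    have "l < m * m" using that by (simp add: power2_eq_square)
    then have "l < m * m" "l mod m < m" "l div m < m"
      by (auto simp: less_mult_imp_div_less intro!: mod_less_divisor gr0I)
    then show ?thesis
      using \<Phi> by (auto simp: vectorize_def sym_outer_def outer_prod_def field_simps)
  qed
  then have "(\<Sum>l<m\<^sup>2. x l * vectorize (sym_outer \<Phi> (i, j)) $ l)
      = (\<Sum>l<m\<^sup>2. (x l * ?V i j $ l + x l * ?V j i $ l) / 2)"
    by (intro sum.cong) (auto simp: algebra_simps)
  also have "\<dots> = ((\<Sum>l<m\<^sup>2. x l * ?V i j $ l) + (\<Sum>l<m\<^sup>2. x l * ?V j i $ l)) / 2"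
    by (simp only: sum.distrib flip: sum_divide_distrib)
  finally show ?thesis
    by (simp add: vectorize_outer_prod_pairing[OF c c] sym_form_def)
qed

text \<open>
  The Fredholm alternative for the system that consists of \<open>\<Psi> r = 0\<close> and the two sum constraints.
\<close>

lemma descent_direction:
  assumes \<Phi>: "\<Phi> \<in> carrier_mat m M"
    and ps: "distinct ps" "set ps = D_plus \<Phi>"
    and ns: "distinct ns" "set ns = D_minus \<Phi>"
    and no_null: "\<not> (\<exists>r \<in> carrier_vec (M + card (D_plus \<Phi>) + card (D_minus \<Phi>)).
              Psi \<Phi> ps ns *\<^sub>v r = 0\<^sub>v (m\<^sup>2) \<and>
              (\<Sum>k = 0..<M. r $ k) = - coherence \<Phi> \<and>
              (\<Sum>k = M..<M + card (D_plus \<Phi>) + card (D_minus \<Phi>). r $ k) = 1)"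
  obtains X a b where "X \<in> carrier_mat m m"
    and "\<And>i. i < M \<Longrightarrow> sym_form X (col \<Phi> i) (col \<Phi> i) = - a"
    and "\<And>i j. (i, j) \<in> D_plus \<Phi> \<Longrightarrow> sym_form X (col \<Phi> i) (col \<Phi> j) = - b"
    and "\<And>i j. (i, j) \<in> D_minus \<Phi> \<Longrightarrow> sym_form X (col \<Phi> i) (col \<Phi> j) = b"
    and "a * coherence \<Phi> < b"
proof -
  define V where "V = map (\<lambda>i. vectorize (outer_prod (col \<Phi> i) (col \<Phi> i))) [0..<M]
      @ map (\<lambda>p. vectorize (sym_outer \<Phi> p)) ps @ map (\<lambda>p. - vectorize (sym_outer \<Phi> p)) ns"
  define N where "N = M + card (D_plus \<Phi>) + card (D_minus \<Phi>)"
  have c: "col \<Phi> k \<in> carrier_vec m" for k using \<Phi> by (metis carrier_matD(1) col_dim)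
  have len_ps: "length ps = card (D_plus \<Phi>)" and len_ns: "length ns = card (D_minus \<Phi>)"
    using ps ns distinct_card by metis+
  have lenV: "length V = N" by (simp add: V_def N_def len_ps len_ns)
  have Psi: "Psi \<Phi> ps ns = mat_of_cols (m\<^sup>2) V" using \<Phi> by (simp add: Psi_def V_def)
  \<comment> \<open>Equations: \<open>Inl l\<close> is row \<open>l\<close> of \<open>\<Psi>\<close>; \<open>Inr False\<close> and \<open>Inr True\<close> are the sum constraints on
    the first \<open>M\<close> unknowns and on the remaining ones.\<close>
  define I :: "(nat + bool) set" where "I = {..<m\<^sup>2} <+> UNIV"
  define A :: "nat \<Rightarrow> nat + bool \<Rightarrow> real" where
    "A k = case_sum (\<lambda>l. V ! k $ l) (\<lambda>later. if later = (M \<le> k) then 1 else 0)" for k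
  define rhs :: "nat + bool \<Rightarrow> real" where
    "rhs = case_sum (\<lambda>_. 0) (\<lambda>later. if later then 1 else - coherence \<Phi>)"
  have sumI: "(\<Sum>e\<in>I. f e) = (\<Sum>l<m\<^sup>2. f (Inl l)) + f (Inr False) + f (Inr True)"
    for f :: "nat + bool \<Rightarrow> real"
    unfolding I_def by (subst sum.Plus) (auto simp: UNIV_bool)
  have "\<not> (\<exists>r. \<forall>e\<in>I. (\<Sum>k<N. r k * A k e) = rhs e)"
  proof
    assume "\<exists>r. \<forall>e\<in>I. (\<Sum>k<N. r k * A k e) = rhs e"
    then obtain r where r: "\<And>e. e \<in> I \<Longrightarrow> (\<Sum>k<N. r k * A k e) = rhs e" by blast
    have split: "(\<Sum>k<N. f k) = (\<Sum>k=0..<M. f k) + (\<Sum>k=M..<N. f k)" for f :: "nat \<Rightarrow> real"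
      by (simp add: N_def sum.atLeastLessThan_concat flip: atLeast0LessThan)
    have "Psi \<Phi> ps ns *\<^sub>v vec N r = 0\<^sub>v (m\<^sup>2)"
    proof (rule eq_vecI)
      fix l assume "l < dim_vec (0\<^sub>v (m\<^sup>2) :: real vec)"
      then have l: "l < m\<^sup>2" by simp
      then have "(Psi \<Phi> ps ns *\<^sub>v vec N r) $ l = (\<Sum>k<N. r k * A k (Inl l))"
        by (auto simp: Psi scalar_prod_def lenV mat_of_cols_index A_def atLeast0LessThan
            intro!: sum.cong)
      also have "\<dots> = 0" using r[of "Inl l"] l by (simp add: I_def rhs_def InlI)
      finally show "(Psi \<Phi> ps ns *\<^sub>v vec N r) $ l = 0\<^sub>v (m\<^sup>2) $ l" using l by simp
    qed (simp add: Psi)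
    moreover have "(\<Sum>k=0..<M. vec N r $ k) = - coherence \<Phi>"
    proof -
      have "(\<Sum>k=0..<M. vec N r $ k) = (\<Sum>k<N. r k * A k (Inr False))"
        unfolding split by (simp add: A_def N_def)
      then show ?thesis using r[of "Inr False"] by (simp add: I_def rhs_def InrI)
    qed
    moreover have "(\<Sum>k=M..<N. vec N r $ k) = 1"
    proof -
      have "(\<Sum>k=M..<N. vec N r $ k) = (\<Sum>k<N. r k * A k (Inr True))"
        unfolding split by (simp add: A_def)
      then show ?thesis using r[of "Inr True"] by (simp add: I_def rhs_def InrI)
    qed
    ultimately show False using no_null unfolding N_def[symmetric] by (metis vec_carrier)
  qed
  then obtain y where y: "\<And>k. k \<in> {..<N} \<Longrightarrow> (\<Sum>e\<in>I. y e * A k e) = 0"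
    and pos: "(\<Sum>e\<in>I. y e * rhs e) > 0"
    by (rule fredholm_alternative[rotated 2]) (auto simp: I_def)
  define X where "X = mat m m (\<lambda>(a, b). y (Inl (b * m + a)))"
  define a where "a = y (Inr False)"
  define b where "b = y (Inr True)"
  have early: "(\<Sum>l<m\<^sup>2. y (Inl l) * V ! k $ l) = - a" if "k < M" for k
    using y[of k] that by (simp add: sumI A_def a_def N_def)
  have late: "(\<Sum>l<m\<^sup>2. y (Inl l) * V ! k $ l) = - b" if "M \<le> k" "k < N" for k
    using y[of k] that by (simp add: sumI A_def b_def)
  show ?thesis
  proof
    show "X \<in> carrier_mat m m" by (simp add: X_def)
    show "sym_form X (col \<Phi> i) (col \<Phi> i) = - a" if "i < M" for i
      using early[OF that] that
      by (simp add: V_def nth_append vectorize_outer_prod_pairing[OF c c] sym_form_def X_def)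
    show "sym_form X (col \<Phi> i) (col \<Phi> j) = - b" if "(i, j) \<in> D_plus \<Phi>" for i j
    proof -
      obtain t where t: "t < length ps" "ps ! t = (i, j)"
        using \<open>(i, j) \<in> D_plus \<Phi>\<close> ps(2) by (metis in_set_conv_nth)
      then have "V ! (M + t) = vectorize (sym_outer \<Phi> (i, j))"
        by (simp add: V_def nth_append)
      then show ?thesis
        using late[of "M + t"] t(1) unfolding X_def vectorize_sym_outer_pairing[OF \<Phi>, of "\<lambda>n. y (Inl n)", symmetric]
        by (simp add: N_def len_ps)
    qed
    show "sym_form X (col \<Phi> i) (col \<Phi> j) = b" if "(i, j) \<in> D_minus \<Phi>" for i j
    proof -
      obtain t where t: "t < length ns" "ns ! t = (i, j)"
        using \<open>(i, j) \<in> D_minus \<Phi>\<close> ns(2) by (metis in_set_conv_nth)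
      then have Vt: "V ! (M + length ps + t) = - vectorize (sym_outer \<Phi> (i, j))"
        by (simp add: V_def nth_append)
      have "dim_vec (vectorize (sym_outer \<Phi> (i, j))) = m\<^sup>2"
        using \<Phi> by (simp add: vectorize_def sym_outer_def outer_prod_def power2_eq_square)
      then have "(\<Sum>l<m\<^sup>2. y (Inl l) * V ! (M + length ps + t) $ l)
          = - (\<Sum>l<m\<^sup>2. y (Inl l) * vectorize (sym_outer \<Phi> (i, j)) $ l)"
        unfolding Vt by (simp flip: sum_negf)
      then show ?thesis
        using late[of "M + length ps + t"] t(1)
        unfolding X_def vectorize_sym_outer_pairing[OF \<Phi>, of "\<lambda>n. y (Inl n)", symmetric]
        by (simp add: N_def len_ps len_ns)
    qed
    show "a * coherence \<Phi> < b"
      using pos by (simp add: sumI rhs_def a_def b_def)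
  qed
qed

section \<open>First-order behaviour of the coherence\<close>

text \<open>
  Both squared norms start as \<open>1 - t * a\<close>, so the product of the norms has derivative \<open>- a\<close> at \<open>0\<close>.
\<close>

lemma normalized_inner_product_derivative:
  fixes c q a :: real
  shows "((\<lambda>t. (c + t * q + t\<^sup>2 * d) / (sqrt (1 - t * a + t\<^sup>2 * e) * sqrt (1 - t * a + t\<^sup>2 * f)))
    has_real_derivative q + a * c) (at 0)"
  by (auto intro!: derivative_eq_intros simp: field_simps)

lemma eventually_less_right:
  fixes g :: "real \<Rightarrow> real"
  assumes "(g has_real_derivative D) (at 0)" and "g 0 < u \<or> g 0 = u \<and> D < 0"
  shows "\<forall>\<^sub>F t in at_right 0. g t < u"
  using assms(2)
proof
  assume "g 0 < u"
  have "(g \<longlongrightarrow> g 0) (at_right 0)"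
    using DERIV_isCont[OF assms(1)] by (auto simp: isCont_def intro: filterlim_mono at_le)
  then show ?thesis using \<open>g 0 < u\<close> by (rule order_tendstoD)
next
  assume "g 0 = u \<and> D < 0"
  with DERIV_neg_dec_right[OF assms(1)] obtain \<delta> where "\<delta> > 0"
    and "\<And>h. 0 < h \<Longrightarrow> h < \<delta> \<Longrightarrow> g h < u" by auto
  then show ?thesis by (auto simp: eventually_at_right_field)
qed

text \<open>
  The determinant is a polynomial in \<open>t\<close> with value \<open>1\<close> at \<open>t = 0\<close>.
\<close>

lemma eventually_invertible:
  fixes X :: "real mat"
  assumes X: "X \<in> carrier_mat m m"
  shows "\<forall>\<^sub>F t in at_right 0. invertible_mat (1\<^sub>m m + (t / 2) \<cdot>\<^sub>m X)"
proof -
  let ?G = "\<lambda>t. 1\<^sub>m m + (t / 2) \<cdot>\<^sub>m X"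
  have G: "?G t \<in> carrier_mat m m" for t using X by simp
  have "isCont (\<lambda>t. det (?G t)) 0"
  proof -
    have "det (?G t) = (\<Sum>p | p permutes {0..<m}. signof p *
        (\<Prod>i = 0..<m. (if i = p i then 1 else 0) + t / 2 * X $$ (i, p i)))" for t
      unfolding det_def'[OF G]
      using X by (intro sum.cong refl arg_cong2[of _ _ _ _ "(*)"] prod.cong)
        (auto simp: permutes_nat_less)
    then show ?thesis by (simp add: continuous_intros)
  qed
  then have "((\<lambda>t. det (?G t)) \<longlongrightarrow> det (?G 0)) (at_right 0)"
    by (auto simp: isCont_def intro: filterlim_mono at_le)
  moreover have "?G 0 = 1\<^sub>m m" using X by (intro eq_matI) auto
  ultimately have "((\<lambda>t. det (?G t)) \<longlongrightarrow> 1) (at_right 0)" by simp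
  then have "\<forall>\<^sub>F t in at_right 0. det (?G t) > 0" by (rule order_tendstoD) simp
  then show ?thesis
  proof eventually_elim
    case (elim t)
    then have "?G t \<in> Units (ring_mat TYPE(real) m ())"
      by (intro det_non_zero_imp_unit[OF G]) simp
    then show ?case
      using X unfolding Units_def ring_mat_def invertible_mat_def inverts_mat_def
      by fastforce
  qed
qed

lemma perturbed_inner_product:
  fixes v w :: "real vec"
  assumes "v \<in> carrier_vec m" "w \<in> carrier_vec m" and X: "X \<in> carrier_mat m m"
  shows "((1\<^sub>m m + (t / 2) \<cdot>\<^sub>m X) *\<^sub>v v) \<bullet> ((1\<^sub>m m + (t / 2) \<cdot>\<^sub>m X) *\<^sub>v w)
    = v \<bullet> w + t * sym_form X v w + t\<^sup>2 * (((X *\<^sub>v v) \<bullet> (X *\<^sub>v w)) / 4)"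
proof -
  have "(1\<^sub>m m + (t / 2) \<cdot>\<^sub>m X) *\<^sub>v u = u + (t / 2) \<cdot>\<^sub>v (X *\<^sub>v u)" if "u \<in> carrier_vec m" for u
    using that X by (intro eq_vecI)
      (auto simp: add_mult_distrib_mat_vec[of _ m m] scalar_prod_def sum_distrib_left intro!: sum.cong)
  moreover have "X *\<^sub>v v \<in> carrier_vec m" "X *\<^sub>v w \<in> carrier_vec m"
    using assms by auto
  ultimately show ?thesis
    using assms
    by (simp add: add_scalar_prod_distrib[of _ m] scalar_prod_add_distrib[of _ m]
        sym_form_def comm_scalar_prod[of w m "X *\<^sub>v v"] field_simps power2_eq_square)
qed

lemma coherence_ge:
  assumes "i < dim_col \<Phi>" "j < dim_col \<Phi>" "i \<noteq> j"
  shows "\<bar>col \<Phi> i \<bullet> col \<Phi> j\<bar> / (l2_norm (col \<Phi> i) * l2_norm (col \<Phi> j)) \<le> coherence \<Phi>"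
proof -
  let ?f = "\<lambda>(i, j). \<bar>col \<Phi> i \<bullet> col \<Phi> j\<bar> / (l2_norm (col \<Phi> i) * l2_norm (col \<Phi> j))"
  let ?S = "{\<bar>col \<Phi> i \<bullet> col \<Phi> j\<bar> / (l2_norm (col \<Phi> i) * l2_norm (col \<Phi> j)) | i j.
     i < dim_col \<Phi> \<and> j < dim_col \<Phi> \<and> i \<noteq> j}"
  have "?S \<subseteq> ?f ` ({..<dim_col \<Phi>} \<times> {..<dim_col \<Phi>})" by auto
  then have "finite ?S" by (rule finite_subset) simp
  then show ?thesis unfolding coherence_def using assms by (intro Max_ge) auto
qed

text \<open>
  Having two columns matters, since the maximum is over a nonempty set only then; by symmetry pairs
  with \<open>i < j\<close> suffice, and these are the pairs that occur in \<open>D_plus\<close> and \<open>D_minus\<close>.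
\<close>

lemma coherence_less:
  assumes "dim_col \<Phi> \<ge> 2"
    and "\<And>i j. i < j \<Longrightarrow> j < dim_col \<Phi> \<Longrightarrow>
      \<bar>col \<Phi> i \<bullet> col \<Phi> j\<bar> / (l2_norm (col \<Phi> i) * l2_norm (col \<Phi> j)) < u"
  shows "coherence \<Phi> < u"
proof -
  let ?f = "\<lambda>(i, j). \<bar>col \<Phi> i \<bullet> col \<Phi> j\<bar> / (l2_norm (col \<Phi> i) * l2_norm (col \<Phi> j))"
  let ?S = "{\<bar>col \<Phi> i \<bullet> col \<Phi> j\<bar> / (l2_norm (col \<Phi> i) * l2_norm (col \<Phi> j)) | i j.
     i < dim_col \<Phi> \<and> j < dim_col \<Phi> \<and> i \<noteq> j}"
  have "?S \<subseteq> ?f ` ({..<dim_col \<Phi>} \<times> {..<dim_col \<Phi>})" by auto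
  then have "finite ?S" by (rule finite_subset) simp
  moreover have "?f (0, 1) \<in> ?S" using assms(1) by fastforce
  moreover have "\<forall>s\<in>?S. s < u"
  proof clarify
    fix i j assume ij: "i < dim_col \<Phi>" "j < dim_col \<Phi>" "i \<noteq> j"
    have "col \<Phi> i \<bullet> col \<Phi> j = col \<Phi> j \<bullet> col \<Phi> i"
      by (rule comm_scalar_prod[of _ "dim_row \<Phi>"]) auto
    then show "\<bar>col \<Phi> i \<bullet> col \<Phi> j\<bar> / (l2_norm (col \<Phi> i) * l2_norm (col \<Phi> j)) < u"
      using assms(2)[of i j] assms(2)[of j i] ij
      by (cases "i < j") (auto simp: mult.commute)
  qed
  ultimately show ?thesis unfolding coherence_def by (subst Max_less_iff) auto
qed

theorem mainTheorem1:
  fixes m M :: nat and \<Phi> :: "real mat" and ps ns :: "(nat \<times> nat) list"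
  assumes "M \<ge> 2"
    and "\<Phi> \<in> carrier_mat m M"
    and "unit_norm_frame m \<Phi>"
    and "distinct ps" and "set ps = D_plus \<Phi>"
    and "distinct ns" and "set ns = D_minus \<Phi>"
    and "\<not> (\<exists>r \<in> carrier_vec (M + card (D_plus \<Phi>) + card (D_minus \<Phi>)).
              Psi \<Phi> ps ns *\<^sub>v r = 0\<^sub>v (m\<^sup>2) \<and>
              (\<Sum>k = 0..<M. r $ k) = - coherence \<Phi> \<and>
              (\<Sum>k = M..<M + card (D_plus \<Phi>) + card (D_minus \<Phi>). r $ k) = 1)"
  shows "\<exists>G \<in> carrier_mat m m. invertible_mat G \<and> coherence (G * \<Phi>) < coherence \<Phi>"
proof -
  note \<Phi> = assms(2)
  obtain X a b where X: "X \<in> carrier_mat m m"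
    and diag: "\<And>i. i < M \<Longrightarrow> sym_form X (col \<Phi> i) (col \<Phi> i) = - a"
    and plus: "\<And>i j. (i, j) \<in> D_plus \<Phi> \<Longrightarrow> sym_form X (col \<Phi> i) (col \<Phi> j) = - b"
    and minus: "\<And>i j. (i, j) \<in> D_minus \<Phi> \<Longrightarrow> sym_form X (col \<Phi> i) (col \<Phi> j) = b"
    and descent: "a * coherence \<Phi> < b"
    using descent_direction[OF \<Phi> assms(4-8)] by metis
  let ?\<mu> = "coherence \<Phi>"
  let ?G = "\<lambda>t. 1\<^sub>m m + (t / 2) \<cdot>\<^sub>m X"
  have c: "col \<Phi> k \<in> carrier_vec m" for k using \<Phi> by (metis carrier_matD(1) col_dim)
  have norm: "l2_norm (col \<Phi> i) = 1" if "i < M" for i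
    using assms(3) \<Phi> that by (auto simp: unit_norm_frame_def)
  then have sq: "col \<Phi> i \<bullet> col \<Phi> i = 1" if "i < M" for i
    using that by (metis l2_norm_def real_sqrt_eq_1_iff)
  have bound: "\<bar>col \<Phi> i \<bullet> col \<Phi> j\<bar> \<le> ?\<mu>" if "i < j" "j < M" for i j
    using coherence_ge[of i \<Phi> j] that \<Phi> norm[of i] norm[of j] by auto
  let ?f = "\<lambda>i j t. \<bar>col (?G t * \<Phi>) i \<bullet> col (?G t * \<Phi>) j\<bar> /
    (l2_norm (col (?G t * \<Phi>) i) * l2_norm (col (?G t * \<Phi>) j))"
  have pair: "\<forall>\<^sub>F t in at_right 0. ?f i j t < ?\<mu>" if ij: "i < j" "j < M" for i j
  proof -
    let ?d = "\<lambda>i j. (X *\<^sub>v col \<Phi> i) \<bullet> (X *\<^sub>v col \<Phi> j) / 4"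
    define p where "p = col \<Phi> i \<bullet> col \<Phi> j"
    define q where "q = sym_form X (col \<Phi> i) (col \<Phi> j)"
    define g where "g t = (p + t * q + t\<^sup>2 * ?d i j) /
      (sqrt (1 - t * a + t\<^sup>2 * ?d i i) * sqrt (1 - t * a + t\<^sup>2 * ?d j j))" for t
    have inner: "col (?G t * \<Phi>) k \<bullet> col (?G t * \<Phi>) l
        = col \<Phi> k \<bullet> col \<Phi> l + t * sym_form X (col \<Phi> k) (col \<Phi> l) + t\<^sup>2 * ?d k l"
      if "k < M" "l < M" for k l t
    proof -
      have "col (?G t * \<Phi>) k = ?G t *\<^sub>v col \<Phi> k" if "k < M" for k
        using that \<Phi> X by (intro col_mult2[of _ m m _ M]) auto
      then show ?thesis using perturbed_inner_product[OF c c X] that by simp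
    qed
    have f_eq: "?f i j t = \<bar>g t\<bar>" for t
    proof -
      have n: "l2_norm (col (?G t * \<Phi>) k) = sqrt (1 - t * a + t\<^sup>2 * ?d k k)" if "k < M" for k
        using that by (simp add: l2_norm_def inner sq diag)
      have l2_nonneg: "0 \<le> l2_norm v" for v
        by (simp add: l2_norm_def scalar_prod_def sum_nonneg)
      have "i < M" using ij by simp
      have "g t = col (?G t * \<Phi>) i \<bullet> col (?G t * \<Phi>) j /
          (l2_norm (col (?G t * \<Phi>) i) * l2_norm (col (?G t * \<Phi>) j))"
        unfolding n[OF \<open>i < M\<close>] n[OF ij(2)] inner[OF \<open>i < M\<close> ij(2)] g_def p_def q_def ..
      then show ?thesis
        by (simp only: abs_divide abs_mult abs_of_nonneg[OF l2_nonneg])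
    qed
    have deriv: "(g has_real_derivative q + a * p) (at 0)"
      unfolding g_def by (rule normalized_inner_product_derivative)
    have g0: "g 0 = p" by (simp add: g_def)
    have p: "\<bar>p\<bar> \<le> ?\<mu>" using bound[OF ij] by (simp add: p_def)
    have q: "p = ?\<mu> \<Longrightarrow> q = - b" "p = - ?\<mu> \<Longrightarrow> q = b"
      using plus[of i j] minus[of i j] ij \<Phi> by (auto simp: D_plus_def D_minus_def p_def q_def)
    \<comment> \<open>Bounding \<open>g\<close> and \<open>- g\<close> separately avoids differentiating the modulus, and with it a separate
      case for coherence \<open>0\<close>.\<close>
    have "g 0 < ?\<mu> \<or> g 0 = ?\<mu> \<and> q + a * p < 0"
      unfolding g0 using p q(1) descent by (cases "p = ?\<mu>") auto
    moreover have "- g 0 < ?\<mu> \<or> - g 0 = ?\<mu> \<and> - (q + a * p) < 0"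
      unfolding g0 using p q(2) descent by (cases "p = - ?\<mu>") auto
    ultimately have "\<forall>\<^sub>F t in at_right 0. g t < ?\<mu>" "\<forall>\<^sub>F t in at_right 0. - g t < ?\<mu>"
      using eventually_less_right[OF deriv] eventually_less_right[OF DERIV_minus[OF deriv]]
      by auto
    then show ?thesis by eventually_elim (use f_eq in auto)
  qed
  have "\<forall>\<^sub>F t in at_right 0. \<forall>e\<in>{(i, j). i < j \<and> j < M}. ?f (fst e) (snd e) t < ?\<mu>"
  proof (rule eventually_ball_finite)
    show "finite {(i, j). i < j \<and> j < M}"
      by (rule finite_subset[of _ "{..<M} \<times> {..<M}"]) auto
  qed (use pair in auto)
  with eventually_invertible[OF X]
  have "\<forall>\<^sub>F t in at_right 0. invertible_mat (?G t) \<and> coherence (?G t * \<Phi>) < ?\<mu>"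
  proof eventually_elim
    case (elim t)
    have "dim_col (?G t * \<Phi>) = M" using \<Phi> by simp
    then show ?case using elim assms(1) by (auto intro!: coherence_less)
  qed
  then obtain t where "invertible_mat (?G t)" "coherence (?G t * \<Phi>) < ?\<mu>"
    using eventually_happens[of _ "at_right (0::real)"] by (auto simp: trivial_limit_at_right_real)
  moreover have "?G t \<in> carrier_mat m m" using X by simp
  ultimately show ?thesis by blast
qed

end
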